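(* Let $A=\langle n_0^{\beta_0}\rangle\cdots\langle n_k^{\beta_k}\rangle\top\in\mathrm{INF}$. Then there is $\psi\in\mathrm{MNF}$ such that $A\equiv\psi$ in $\mathbf{TSC}$ and $\psi=\langle n_0^{\alpha_0}\rangle\top\wedge\cdots\wedge\langle n_k^{\alpha_k}\rangle\top$, where $\alpha_k=\beta_k$ and, for all $0\le i<k$, $\alpha_i=e^{n_{i+1}-n_i}(\alpha_{i+1})\cdot(1+\beta_i)$.
   Context: Ordinals range below $\varepsilon_0$. $\mathbb{F}_{\varepsilon_0}$ is the least set containing $\top$, closed under $\wedge$ and under unary modalities $\langle n^\alpha\rangle$ ($n<\omega$, $\alpha<\varepsilon_0$); $\langle n^0\rangle\varphi$ denotes $\varphi$. An ordinal worm is a formula $\langle m_0^{\gamma_0}\rangle\cdots\langle m_j^{\gamma_j}\rangle\top$ (including $\top$). INF (increasing normal forms): $\top$ and worms built by prefixing $\langle n^\alpha\rangle$ with $0<\alpha$ to a worm in INF whose first modality $\langle m^\beta\rangle$ has $n<m$ (so the bases strictly increase from left to right). Hyper-exponentials: $e^0=\mathrm{id}$, $e^1(\alpha)=-1+\omega^\alpha$, $e^{n+m}=e^n\circ e^m$. MNF is the least set with: $\top\in$ MNF; each monomial $\langle n^\alpha\rangle\top\in$ MNF; if $\langle n_0^{\alpha_0}\rangle\top\wedge\cdots\wedge\langle n_k^{\alpha_k}\rangle\top\in$ MNF, $n<n_0$, and $\alpha=e^{n_0-n}(\alpha_0)\cdot(2+\beta)$ for some $\beta<\varepsilon_0$,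 then $\langle n^\alpha\rangle\top\wedge\langle n_0^{\alpha_0}\rangle\top\wedge\cdots\wedge\langle n_k^{\alpha_k}\rangle\top\in$ MNF. $\mathbf{TSC}$ derives sequents $\varphi\vdash\psi$; $\varphi\equiv\psi$ means both directions derivable. Axioms: $\varphi\vdash\varphi$; $\varphi\vdash\top$; $\varphi\wedge\psi\vdash\varphi$; $\varphi\wedge\psi\vdash\psi$; $\langle n^\alpha\rangle\varphi\vdash\langle n^\beta\rangle\varphi$ for $\beta\le\alpha$; $\langle n^{\alpha+\beta}\rangle\varphi\equiv\langle n^\beta\rangle\langle n^\alpha\rangle\varphi$; $\langle(m+n)^\alpha\rangle\varphi\vdash\langle m^{e^n(\alpha)}\rangle\varphi$; Schmerl axioms $\langle n^\alpha\rangle(\langle n_0^{\alpha_0}\rangle\top\wedge\cdots\wedge\langle n_k^{\alpha_k}\rangle\top)\equiv\langle n^{e^{n_0-n}(\alpha_0)\cdot(1+\alpha)}\rangle\top\wedge\langle n_0^{\alpha_0}\rangle\top\wedge\cdots\wedge\langle n_k^{\alpha_k}\rangle\top$ for $n<n_0$ and the conjunction in MNF. Rules: from $\varphi\vdash\psi$, $\varphi\vdash\chi$ infer $\varphi\vdash\psi\wedge\chi$; from $\varphi\vdash\psi$, $\psi\vdash\chi$ infer $\varphi\vdash\chi$; from $\varphi\vdash\psi$ infer $\langle n^\alpha\rangle\varphi\vdash\langle n^\alpha\rangle\psi$; from $\varphi\vdash\psi$ infer $\langle n^\alpha\rangle\varphi\wedge\langle m^{\beta+1}\rangle\psi\vdash\langle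 n^\alpha\rangle(\varphi\wedge\langle m^{\beta+1}\rangle\psi)$ for $m<n$. *)

theory Defs
  imports Main
begin

section \<open>Ordinals below \<open>\<epsilon>\<^sub>0\<close>\<close>

text \<open>
  Ordinals below \<open>\<epsilon>\<^sub>0\<close> are represented by their Cantor normal forms:
  \<open>CZero\<close> stands for \<open>0\<close> and \<open>CAdd a b\<close> for \<open>\<omega>\<^sup>a + b\<close>, where in a normal form the
  leading exponent of \<open>b\<close> is at most \<open>a\<close>.
\<close>

datatype cnf = CZero | CAdd cnf cnf

instantiation cnf :: linorder
begin

fun less_cnf :: "cnf \<Rightarrow> cnf \<Rightarrow> bool" where
  "less_cnf x CZero \<longleftrightarrow> False"
| "less_cnf CZero (CAdd c d) \<longleftrightarrow> True"
| "less_cnf (CAdd a b) (CAdd c d) \<longleftrightarrow> less_cnf a c \<or> a = c \<and> less_cnf b d"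

definition less_eq_cnf :: "cnf \<Rightarrow> cnf \<Rightarrow> bool" where
  "less_eq_cnf x y \<longleftrightarrow> x < y \<or> x = y"

instance
proof
  have irr: "\<not> x < x" for x :: cnf
    by (induction x) auto
  have tr: "x < y \<Longrightarrow> y < z \<Longrightarrow> x < z" for x y z :: cnf
  proof (induction x arbitrary: y z)
    case CZero
    then show ?case by (cases y; cases z) auto
  next
    case (CAdd a b)
    then show ?case by (cases y; cases z) auto
  qed
  have tot: "x < y \<or> x = y \<or> y < x" for x y :: cnf
  proof (induction x arbitrary: y)
    case CZero
    then show ?case by (cases y) auto
  next
    case (CAdd a b)
    then show ?case by (cases y) auto
  qed
  fix x y z :: cnf
  show "x < y \<longleftrightarrow> x \<le> y \<and> \<not> y \<le> x"
    using irr tr by (auto simp: less_eq_cnf_def)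
  show "x \<le> x" by (simp add: less_eq_cnf_def)
  show "x \<le> y \<Longrightarrow> y \<le> z \<Longrightarrow> x \<le> z"
    using tr by (auto simp: less_eq_cnf_def)
  show "x \<le> y \<Longrightarrow> y \<le> x \<Longrightarrow> x = y"
    using irr tr by (auto simp: less_eq_cnf_def)
  show "x \<le> y \<or> y \<le> x"
    using tot by (auto simp: less_eq_cnf_def)
qed

end

fun lead_le :: "cnf \<Rightarrow> cnf \<Rightarrow> bool" where
  "lead_le CZero a \<longleftrightarrow> True"
| "lead_le (CAdd c d) a \<longleftrightarrow> c \<le> a"

fun nf :: "cnf \<Rightarrow> bool" where
  "nf CZero \<longleftrightarrow> True"
| "nf (CAdd a b) \<longleftrightarrow> nf a \<and> nf b \<and> lead_le b a"

fun cadd :: "cnf \<Rightarrow> cnf \<Rightarrow> cnf" where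
  "cadd CZero y = y"
| "cadd (CAdd a b) CZero = CAdd a b"
| "cadd (CAdd a b) (CAdd c d) = (if a < c then CAdd c d else CAdd a (cadd b (CAdd c d)))"

text \<open>
  Multiplication is computed from \<open>x \<cdot> (\<omega>\<^sup>c + d) = x \<cdot> \<omega>\<^sup>c + x \<cdot> d\<close> and from
  \<open>(\<omega>\<^sup>a + b) \<cdot> \<omega>\<^sup>c = \<omega>\<^bsup>a+c\<^esup>\<close> for \<open>c > 0\<close>.
\<close>

fun cmul :: "cnf \<Rightarrow> cnf \<Rightarrow> cnf" where
  "cmul x CZero = CZero"
| "cmul CZero (CAdd c d) = CZero"
| "cmul (CAdd a b) (CAdd c d) =
     (if c = CZero then cadd (CAdd a b) (cmul (CAdd a b) d)
      else CAdd (cadd a c) (cmul (CAdd a b) d))"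

lemma CZero_le [simp]: "CZero \<le> x"
  by (cases x) (auto simp: less_eq_cnf_def)

lemma less_CZero_iff: "CZero < x \<longleftrightarrow> x \<noteq> CZero"
  by (cases x) auto

lemma cadd_CZero [simp]: "cadd x CZero = x"
  by (cases x) auto

lemma lead_le_cadd: "lead_le x a \<Longrightarrow> lead_le y a \<Longrightarrow> lead_le (cadd x y) a"
  by (cases x; cases y) auto

lemma lead_le_caddD: "lead_le (cadd x y) a \<Longrightarrow> lead_le y a"
  by (cases x; cases y) (auto split: if_splits)

lemma lead_le_trans: "lead_le x a \<Longrightarrow> a \<le> b \<Longrightarrow> lead_le x b"
  by (cases x) auto

lemma nf_cadd: "nf x \<Longrightarrow> nf y \<Longrightarrow> nf (cadd x y)"
proof (induction x)
  case (CAdd a b)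
  then show ?case by (cases y) (auto simp: lead_le_cadd)
qed simp

lemma cadd_assoc: "cadd (cadd x y) z = cadd x (cadd y z)"
proof (induction x)
  case (CAdd a b)
  show ?case
  proof (cases y)
    case y: (CAdd c d)
    then show ?thesis using CAdd by (cases z) auto
  qed simp
qed simp

lemma cadd_less_right: "y < z \<Longrightarrow> cadd x y < cadd x z"
proof (induction x)
  case (CAdd a b)
  then show ?case by (cases y; cases z) auto
qed simp

lemma cadd_lead_le: "lead_le z a \<Longrightarrow> cadd (CAdd a b) z = CAdd a (cadd b z)"
  by (cases z) auto

lemma cadd_diff: "x \<le> y \<Longrightarrow> nf y \<Longrightarrow> \<exists>z. nf z \<and> y = cadd x z"
proof (induction x arbitrary: y)
  case (CAdd a b)
  then obtain c d where y: "y = CAdd c d"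
    by (cases y) (auto simp: less_eq_cnf_def)
  consider "a < c" | "a = c" "b \<le> d"
    using CAdd.prems by (auto simp: y less_eq_cnf_def)
  then show ?case
  proof cases
    case 1
    then show ?thesis using CAdd.prems by (intro exI[of _ y]) (auto simp: y)
  next
    case 2
    then obtain z where z: "nf z" "d = cadd b z"
      using CAdd.IH(2)[of d] CAdd.prems by (auto simp: y)
    have "lead_le z a"
      using CAdd.prems 2 z lead_le_caddD by (auto simp: y)
    then show ?thesis
      using z 2 by (intro exI[of _ z]) (auto simp: y cadd_lead_le)
  qed
qed auto

lemma cmul_shape:
  "nf (CAdd a b) \<Longrightarrow> nf (CAdd c d) \<Longrightarrow> \<exists>t. cmul (CAdd a b) (CAdd c d) = CAdd (cadd a c) t"
proof (induction d arbitrary: c)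
  case CZero
  then show ?case by auto
next
  case (CAdd e f)
  show ?case
  proof (cases "c = CZero")
    case True
    then have "e = CZero"
      using CAdd.prems by (auto simp: less_eq_cnf_def)
    moreover have "nf (CAdd e f)"
      using CAdd.prems by auto
    ultimately obtain t where "cmul (CAdd a b) (CAdd e f) = CAdd a t"
      using CAdd.IH(2)[of e] CAdd.prems(1) by auto
    then show ?thesis using True by simp
  qed simp
qed

lemma cadd_mono: "y \<le> z \<Longrightarrow> cadd x y \<le> cadd x z"
  using cadd_less_right[of y z x] by (auto simp: less_eq_cnf_def)

lemma lead_le_cmul:
  assumes "nf (CAdd a b)" "nf y" "lead_le y c"
  shows "lead_le (cmul (CAdd a b) y) (cadd a c)"
proof (cases y)
  case (CAdd e f)
  then show ?thesis
    using cmul_shape[of a b e f] assms by (auto simp: cadd_mono simp del: cmul.simps)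
qed simp

lemma nf_cmul: "nf x \<Longrightarrow> nf y \<Longrightarrow> nf (cmul x y)"
proof (induction y)
  case (CAdd c d)
  then show ?case
    by (cases x) (auto intro!: nf_cadd lead_le_cmul simp del: cadd.simps)
qed simp

lemma cmul_cadd: "nf x \<Longrightarrow> nf y \<Longrightarrow> nf z \<Longrightarrow> cmul x (cadd y z) = cadd (cmul x y) (cmul x z)"
proof (induction y)
  case (CAdd c d)
  show ?case
  proof (cases z)
    case z: (CAdd e f)
    show ?thesis
    proof (cases x)
      case x: (CAdd a b)
      obtain s where s: "cmul x (CAdd c d) = CAdd (cadd a c) s"
        using cmul_shape CAdd.prems x by blast
      obtain t where t: "cmul x (CAdd e f) = CAdd (cadd a e) t"
        using cmul_shape CAdd.prems x z by blast
      show ?thesis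
      proof (cases "c < e")
        case True
        then show ?thesis using s t z cadd_less_right by auto
      next
        case False
        have IH: "cmul x (cadd d z) = cadd (cmul x d) (cmul x z)"
          using CAdd by auto
        have l: "lead_le (cmul x z) (cadd a c)"
          using lead_le_cmul[of a b z c] CAdd.prems x z False
          by (auto simp: not_less simp del: cmul.simps)
        show ?thesis
        proof (cases "c = CZero")
          case True
          then show ?thesis using IH False z x by (auto simp: cadd_assoc[symmetric])
        next
          case nz: False
          have "cmul x (cadd (CAdd c d) z) = CAdd (cadd a c) (cmul x (cadd d z))"
            using nz False z x by simp
          also have "\<dots> = cadd (cmul x (CAdd c d)) (cmul x z)"
            using nz x IH l cadd_lead_le by simp
          finally show ?thesis .
        qed
      qed
    qed (use z in auto)
  qed simp
qed simp

typedef eps0 = "{x. nf x}"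
  morphisms cnf_of Eps0
  by (rule exI[of _ CZero]) simp

setup_lifting type_definition_eps0

lemma wf_nf: "wf {(x, y). nf x \<and> nf y \<and> x < y}" (is "wf ?R")
proof (rule acc_wfI, rule allI)
  have step: "CAdd a b \<in> Wellfounded.acc ?R"
    if "a \<in> Wellfounded.acc ?R" "nf (CAdd a b)" for a b
    using that
  proof (induction a arbitrary: b rule: acc.induct)
    case (accI a)
    note IH = accI.IH
    have inner: "CAdd a b \<in> Wellfounded.acc ?R"
      if "b \<in> Wellfounded.acc ?R" "nf (CAdd a b)" for b
      using that
    proof (induction b rule: acc.induct)
      case (accI b)
      show ?case
      proof (rule acc.accI)
        fix y assume y: "(y, CAdd a b) \<in> ?R"
        show "y \<in> Wellfounded.acc ?R"
        proof (cases y)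
          case CZero
          show ?thesis unfolding CZero by (rule acc.accI) auto
        next
          case (CAdd c d)
          then show ?thesis
            using y accI IH by auto
        qed
      qed
    qed
    have "b \<in> Wellfounded.acc ?R" if "nf (CAdd a b)" for b
      using that
    proof (induction b)
      case CZero
      show ?case by (rule acc.accI) auto
    next
      case (CAdd c d)
      consider "c < a" | "c = a" using CAdd.prems by (auto simp: less_eq_cnf_def)
      then show ?case
      proof cases
        case 1
        then show ?thesis
          using CAdd.prems IH by auto
      next
        case 2
        then show ?thesis using CAdd inner by auto
      qed
    qed
    then show ?case using inner accI.prems by blast
  qed
  fix x :: cnf
  show "x \<in> Wellfounded.acc ?R"
  proof (cases "nf x")
    case True
    then show ?thesis
    proof (induction x)
      case CZero
      show ?case by (rule acc.accI) auto
    next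
      case (CAdd a b)
      then show ?case using step by auto
    qed
  qed (rule acc.accI, auto)
qed

instantiation eps0 :: "{wellorder, monoid_add, numeral, times}"
begin

lift_definition less_eps0 :: "eps0 \<Rightarrow> eps0 \<Rightarrow> bool" is "(<)" .
lift_definition less_eq_eps0 :: "eps0 \<Rightarrow> eps0 \<Rightarrow> bool" is "(\<le>)" .
lift_definition zero_eps0 :: eps0 is CZero by simp
lift_definition one_eps0 :: eps0 is "CAdd CZero CZero" by simp
lift_definition plus_eps0 :: "eps0 \<Rightarrow> eps0 \<Rightarrow> eps0" is cadd by (simp add: nf_cadd)
lift_definition times_eps0 :: "eps0 \<Rightarrow> eps0 \<Rightarrow> eps0" is cmul by (simp add: nf_cmul)

instance
proof
  fix a b c :: eps0
  show "a < b \<longleftrightarrow> a \<le> b \<and> \<not> b \<le> a" by transfer auto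
  show "a \<le> a" by transfer simp
  show "a \<le> b \<Longrightarrow> b \<le> c \<Longrightarrow> a \<le> c" by transfer simp
  show "a \<le> b \<Longrightarrow> b \<le> a \<Longrightarrow> a = b" by transfer simp
  show "a \<le> b \<or> b \<le> a" by transfer auto
  show "a + b + c = a + (b + c)" by transfer (simp add: cadd_assoc)
  show "0 + a = a" by transfer simp
  show "a + 0 = a" by transfer simp
next
  fix P :: "eps0 \<Rightarrow> bool" and a :: eps0
  assume IH: "\<And>x. (\<And>y. y < x \<Longrightarrow> P y) \<Longrightarrow> P x"
  have "wf {(x, y :: eps0). x < y}"
    by (rule wf_subset[OF wf_inv_image[OF wf_nf, of cnf_of]])
       (use cnf_of in \<open>auto simp: inv_image_def less_eps0.rep_eq\<close>)
  then show "P a"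
    by (induction a rule: wf_induct_rule) (use IH in auto)
qed

end

lift_definition omega_exp :: "eps0 \<Rightarrow> eps0" is "\<lambda>a. CAdd a CZero" by simp

subsection \<open>The operations are the usual ordinal operations\<close>

text \<open>
  For fixed \<open>\<alpha>\<close>, the map \<open>\<beta> \<mapsto> \<alpha> + \<beta>\<close> is the order isomorphism onto the ordinals \<open>\<ge> \<alpha>\<close>.
\<close>

lemma eps0_zero_le [simp]: "(0 :: eps0) \<le> \<alpha>"
  by transfer simp

lemma eps0_pos_iff: "0 < \<alpha> \<longleftrightarrow> \<alpha> \<noteq> (0 :: eps0)"
  by transfer (simp add: less_CZero_iff)

lemma eps0_add_strict_mono: "\<beta> < \<gamma> \<Longrightarrow> \<alpha> + \<beta> < \<alpha> + (\<gamma> :: eps0)"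
  by transfer (rule cadd_less_right)

lemma eps0_le_iff_add: "\<alpha> \<le> \<beta> \<longleftrightarrow> (\<exists>\<gamma> :: eps0. \<beta> = \<alpha> + \<gamma>)"
proof
  show "\<alpha> \<le> \<beta> \<Longrightarrow> \<exists>\<gamma>. \<beta> = \<alpha> + \<gamma>"
    by transfer (use cadd_diff in auto)
  assume "\<exists>\<gamma>. \<beta> = \<alpha> + \<gamma>"
  then obtain \<gamma> where "\<beta> = \<alpha> + \<gamma>" ..
  then show "\<alpha> \<le> \<beta>"
    using eps0_add_strict_mono[of 0 \<gamma> \<alpha>] by (cases "\<gamma> = 0") (auto simp: eps0_pos_iff)
qed

lemma eps0_add_left_cancel: "\<alpha> + \<beta> = \<alpha> + \<gamma> \<longleftrightarrow> \<beta> = (\<gamma> :: eps0)"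
  using eps0_add_strict_mono[of \<beta> \<gamma> \<alpha>] eps0_add_strict_mono[of \<gamma> \<beta> \<alpha>]
  by (cases \<beta> \<gamma> rule: linorder_cases) auto

lemma eps0_less_add_one_iff: "\<alpha> < \<beta> + 1 \<longleftrightarrow> \<alpha> \<le> (\<beta> :: eps0)"
proof
  assume *: "\<alpha> < \<beta> + 1"
  show "\<alpha> \<le> \<beta>"
  proof (rule ccontr)
    assume "\<not> \<alpha> \<le> \<beta>"
    then obtain \<gamma> where \<gamma>: "\<alpha> = \<beta> + \<gamma>" "\<gamma> \<noteq> 0"
      using eps0_le_iff_add[of \<beta> \<alpha>] by (metis add_0_right linear order_refl)
    have "1 \<le> \<gamma>"
      using \<gamma>(2)
    proof transfer
      fix g assume "g \<noteq> CZero"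
      then show "CAdd CZero CZero \<le> g"
        by (cases g) (auto simp: less_eq_cnf_def less_CZero_iff)
    qed
    then have "\<beta> + 1 \<le> \<beta> + \<gamma>"
      using eps0_add_strict_mono[of 1 \<gamma> \<beta>] by (cases "\<gamma> = 1") (auto simp: less_le)
    then show False using * \<gamma> by simp
  qed
next
  assume "\<alpha> \<le> \<beta>"
  moreover have "\<beta> < \<beta> + 1"
    using eps0_add_strict_mono[of 0 1 \<beta>] by (simp add: less_eps0.rep_eq zero_eps0.rep_eq one_eps0.rep_eq)
  ultimately show "\<alpha> < \<beta> + 1" by simp
qed

text \<open>
  For fixed \<open>\<alpha> > 0\<close>, the map \<open>(\<delta>, \<rho>) \<mapsto> \<alpha> \<cdot> \<delta> + \<rho>\<close> (with \<open>\<rho> < \<alpha>\<close>) is onto, and the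
  product obeys the recursion clauses for \<open>0\<close>, successors and sums.
\<close>

lemma eps0_mult_zero [simp]: "\<alpha> * 0 = (0 :: eps0)"
  by transfer simp

lemma eps0_zero_mult [simp]: "0 * \<alpha> = (0 :: eps0)"
  by transfer (metis cmul.simps(1,2) cnf.exhaust)

lemma eps0_mult_one [simp]: "\<alpha> * 1 = (\<alpha> :: eps0)"
proof transfer
  fix a show "cmul a (CAdd CZero CZero) = a" by (cases a) auto
qed

lemma eps0_distrib: "\<alpha> * (\<beta> + \<gamma>) = \<alpha> * \<beta> + \<alpha> * (\<gamma> :: eps0)"
  by transfer (simp add: cmul_cadd)

lemma eps0_mult_add_one: "\<alpha> * (\<beta> + 1) = \<alpha> * \<beta> + (\<alpha> :: eps0)"
  by (simp add: eps0_distrib)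

lemma less_CAdd: "nf (CAdd a b) \<Longrightarrow> b < CAdd a b"
proof (induction b arbitrary: a)
  case (CAdd c d)
  then have "d < CAdd c d" by auto
  then show ?case using CAdd.prems by (auto simp: less_eq_cnf_def)
qed simp

lemma exponent_less_CAdd: "nf (CAdd a b) \<Longrightarrow> a < CAdd a b"
proof (induction a arbitrary: b)
  case (CAdd c d)
  then have "c < CAdd c d" by auto
  then show ?case by auto
qed simp

lemma eps0_less_omega_exp: "\<alpha> < omega_exp \<alpha>"
  by transfer (simp add: exponent_less_CAdd)

lemma eps0_mult_pos: "0 < \<alpha> \<Longrightarrow> 0 < \<beta> \<Longrightarrow> 0 < \<alpha> * (\<beta> :: eps0)"
proof transfer
  fix a b assume "nf a" "nf b" "CZero < a" "CZero < b"
  then show "CZero < cmul a b"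
    using cmul_shape by (cases a; cases b) (fastforce simp del: cmul.simps)+
qed

lemma eps0_mult_strict_mono:
  assumes "0 < \<alpha>" "\<beta> < \<gamma>"
  shows "\<alpha> * \<beta> < \<alpha> * (\<gamma> :: eps0)"
proof -
  obtain \<delta> where \<delta>: "\<gamma> = \<beta> + \<delta>"
    using assms eps0_le_iff_add[of \<beta> \<gamma>] by auto
  have "\<delta> \<noteq> 0" using assms \<delta> by auto
  then have "0 < \<alpha> * \<delta>"
    using assms eps0_mult_pos eps0_zero_le[of \<delta>] by (simp add: order_less_le)
  then show ?thesis
    using eps0_add_strict_mono[of 0 "\<alpha> * \<delta>" "\<alpha> * \<beta>"] by (simp add: \<delta> eps0_distrib)
qed

lemma cnf_division:
  assumes "nf g" "nf x" "x \<noteq> CZero"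
  shows "\<exists>d r. nf d \<and> nf r \<and> r < x \<and> g = cadd (cmul x d) r"
  using assms(1)
proof (induction g rule: wf_induct_rule[OF wf_nf])
  case (1 g)
  obtain a b where x: "x = CAdd a b" using assms by (cases x) auto
  show ?case
  proof (cases "g < x")
    case True
    then show ?thesis using 1 by (intro exI[of _ CZero] exI[of _ g]) auto
  next
    case False
    then obtain c d where g: "g = CAdd c d" by (cases g) (auto simp: x)
    consider "a < c" | "a = c" "b \<le> d" using False by (cases "a = c") (auto simp: x g)
    then show ?thesis
    proof cases
      case 1
      then obtain e where e: "nf e" "c = cadd a e"
        using cadd_diff[of a c] \<open>nf g\<close> less_imp_le[of a c] by (auto simp: g)
      then have "e \<noteq> CZero" using 1 by auto
      obtain q r where qr: "nf q" "nf r" "r < x" "d = cadd (cmul x q) r"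
        using "1.IH"[of d] "1.prems" less_CAdd by (auto simp: g)
      have "cadd (cmul x (cadd (CAdd e CZero) q)) r = cadd (cadd (cmul x (CAdd e CZero)) (cmul x q)) r"
        using cmul_cadd assms e qr by simp
      also have "\<dots> = cadd (CAdd c CZero) d"
        using \<open>e \<noteq> CZero\<close> by (simp add: cadd_assoc qr x e)
      also have "\<dots> = g"
        using "1.prems" by (simp add: g cadd_lead_le)
      finally show ?thesis
        using qr e nf_cadd[of "CAdd e CZero" q] by fastforce
    next
      case 2
      have le: "x \<le> g" using False by simp
      then obtain h where h: "nf h" "g = cadd x h"
        using cadd_diff "1.prems" by blast
      have "h < g"
      proof -
        have hl: "lead_le h a"
          using lead_le_caddD[of x h a] 2 by (simp add: h(2)[symmetric] g)
        then have "CAdd a (cadd b h) = g" using h by (simp add: x cadd_lead_le)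
        then have d: "d = cadd b h" by (simp add: g)
        show ?thesis
        proof (rule ccontr)
          assume "\<not> h < g"
          then obtain h' where h': "h = CAdd a h'" "\<not> h' < d"
            using hl 2 by (cases h) (auto simp: g)
          have "lead_le b a" using assms by (simp add: x)
          have "h \<le> cadd b h"
          proof -
            have "h \<le> cadd y h" if "nf y" for y
              using that
            proof (induction y)
              case (CAdd u v)
              then have IH: "h \<le> cadd v h" by simp
              show ?case
              proof (cases "u < a")
                case False
                have "h' < h" using less_CAdd h(1) by (simp add: h')
                then have "h' < cadd v h" using IH by simp
                then show ?thesis using False by (auto simp: h' less_eq_cnf_def)
              qed (simp add: h')
            qed simp
            then show ?thesis using assms by (simp add: x)
          qed
          moreover have "h' < h" using less_CAdd h(1) by (simp add: h')
          ultimately show False using h' d by auto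
        qed
      qed
      then obtain q r where qr: "nf q" "nf r" "r < x" "h = cadd (cmul x q) r"
        using "1.IH"[of h] "1.prems" h by auto
      have one: "cmul x (CAdd CZero CZero) = x" by (simp add: x)
      have "cadd (cmul x (cadd (CAdd CZero CZero) q)) r = g"
        using cmul_cadd[of x "CAdd CZero CZero" q] assms qr h one by (simp add: cadd_assoc)
      then show ?thesis
        using qr nf_cadd[of "CAdd CZero CZero" q] by fastforce
    qed
  qed
qed

lemma eps0_division:
  "0 < \<alpha> \<Longrightarrow> \<exists>\<delta> \<rho>. \<rho> < \<alpha> \<and> \<gamma> = \<alpha> * \<delta> + (\<rho> :: eps0)"
  by transfer (use cnf_division in \<open>fastforce simp: less_CZero_iff\<close>)

lemma omega_exp_zero: "omega_exp 0 = 1"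
  by transfer simp

lemma omega_exp_add: "omega_exp (\<alpha> + \<beta>) = omega_exp \<alpha> * omega_exp \<beta>"
  by transfer auto

lemma omega_exp_strict_mono: "\<alpha> < \<beta> \<Longrightarrow> omega_exp \<alpha> < omega_exp \<beta>"
  by transfer auto

lemma less_omega_exp_limit:
  assumes "\<gamma> < omega_exp \<beta>" "\<beta> \<noteq> 0" "\<And>\<delta>. \<delta> < \<beta> \<Longrightarrow> \<delta> + 1 < \<beta>"
  shows "\<exists>\<delta><\<beta>. \<gamma> < omega_exp \<delta>"
proof (cases "\<gamma> = 0")
  case True
  have "0 < \<beta>" using assms(2) eps0_zero_le[of \<beta>] by (simp add: order_less_le)
  then show ?thesis using True by (intro exI[of _ 0]) (auto simp: eps0_less_omega_exp)
next
  case False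
  have "\<exists>\<delta><\<beta>. \<gamma> < omega_exp (\<delta> + 1)"
    using assms(1) False
  proof transfer
    fix g b assume *: "nf g" "nf b" "g < CAdd b CZero" "g \<noteq> CZero"
    then obtain c d where g: "g = CAdd c d" by (cases g) auto
    have "c < cadd c (CAdd CZero CZero)"
      using cadd_less_right[of CZero "CAdd CZero CZero" c] by simp
    then show "\<exists>\<delta>\<in>{x. nf x}. \<delta> < b \<and> g < CAdd (cadd \<delta> (CAdd CZero CZero)) CZero"
      using * by (intro bexI[of _ c]) (auto simp: g)
  qed
  then show ?thesis using assms(3) by blast
qed

lemma less_omega_iff: "\<alpha> < omega_exp 1 \<longleftrightarrow> (\<exists>k :: nat. \<alpha> = ((+) 1 ^^ k) 0)"
proof
  assume "\<alpha> < omega_exp 1"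
  then show "\<exists>k. \<alpha> = ((+) 1 ^^ k) 0"
  proof (induction \<alpha> rule: less_induct)
    case (less \<alpha>)
    show ?case
    proof (cases "\<alpha> = 0")
      case True
      then show ?thesis by (intro exI[of _ 0]) simp
    next
      case False
      have "\<exists>\<beta><\<alpha>. \<alpha> = 1 + \<beta>"
        using False less.prems
      proof transfer
        fix a assume *: "nf a" "a \<noteq> CZero" "a < CAdd (CAdd CZero CZero) CZero"
        then obtain d where a: "a = CAdd CZero d"
          by (cases a) (auto elim: less_cnf.elims)
        then have "nf d" "lead_le d CZero" "d < a"
          using * less_CAdd[of CZero d] by auto
        moreover from this have "a = cadd (CAdd CZero CZero) d"
          by (simp only: a cadd_lead_le cadd.simps)
        ultimately show "\<exists>\<beta>\<in>{x. nf x}. \<beta> < a \<and> a = cadd (CAdd CZero CZero) \<beta>"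
          by blast
      qed
      then obtain \<beta> where \<beta>: "\<beta> < \<alpha>" "\<alpha> = 1 + \<beta>" by blast
      then obtain k where "\<beta> = ((+) 1 ^^ k) 0"
        using less by force
      then show ?thesis using \<beta> by (intro exI[of _ "Suc k"]) simp
    qed
  qed
next
  have "((+) 1 ^^ k) 0 < omega_exp 1" for k :: nat
  proof (induction k)
    case 0
    then show ?case by simp (transfer, simp)
  next
    case (Suc k)
    have "1 + \<beta> < omega_exp 1" if "\<beta> < omega_exp 1" for \<beta>
      using that
    proof transfer
      fix b assume "b < CAdd (CAdd CZero CZero) CZero"
      then show "cadd (CAdd CZero CZero) b < CAdd (CAdd CZero CZero) CZero"
        by (cases b) (auto simp: less_eq_cnf_def)
    qed
    then show ?case using Suc by simp
  qed
  then show "\<exists>k. \<alpha> = ((+) 1 ^^ k) 0 \<Longrightarrow> \<alpha> < omega_exp 1" by blast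
qed

text \<open>No proper subset containing \<open>0\<close> is closed under \<open>+\<close> and \<open>\<alpha> \<mapsto> \<omega>\<^sup>\<alpha>\<close>, so the order type is \<open>\<epsilon>\<^sub>0\<close>.\<close>

lemma eps0_induct:
  assumes "P 0" "\<And>\<alpha> \<beta>. P \<alpha> \<Longrightarrow> P \<beta> \<Longrightarrow> P (omega_exp \<alpha> + \<beta>)"
  shows "P \<alpha>"
proof -
  have "P (Eps0 x)" if "nf x" for x
    using that
  proof (induction x)
    case CZero
    then show ?case using assms(1) by (simp add: zero_eps0_def)
  next
    case (CAdd a b)
    have "Eps0 (CAdd a b) = omega_exp (Eps0 a) + Eps0 b"
      using CAdd.prems
      by (simp add: plus_eps0_def omega_exp_def Eps0_inverse cadd_lead_le)
    then show ?case using CAdd assms(2) by simp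
  qed
  then show ?thesis using cnf_of[of \<alpha>] cnf_of_inverse[of \<alpha>] by (metis mem_Collect_eq)
qed

subsection \<open>Hyper-exponentials\<close>

text \<open>\<open>left_diff \<alpha> \<beta>\<close> is the ordinal \<open>-\<alpha> + \<beta>\<close>; it is meaningful for \<open>\<alpha> \<le> \<beta>\<close>.\<close>

definition left_diff :: "eps0 \<Rightarrow> eps0 \<Rightarrow> eps0" where
  "left_diff \<alpha> \<beta> = (THE \<gamma>. \<alpha> + \<gamma> = \<beta>)"

lemma add_left_diff: "\<alpha> \<le> \<beta> \<Longrightarrow> \<alpha> + left_diff \<alpha> \<beta> = \<beta>"
  unfolding left_diff_def
  by (rule theI') (metis eps0_le_iff_add eps0_add_left_cancel)

definition hyperexp :: "nat \<Rightarrow> eps0 \<Rightarrow> eps0" where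
  "hyperexp n = (\<lambda>\<alpha>. left_diff 1 (omega_exp \<alpha>)) ^^ n"

lemma hyperexp_zero: "hyperexp 0 = id"
  by (simp add: hyperexp_def)

lemma hyperexp_one: "hyperexp 1 \<alpha> = left_diff 1 (omega_exp \<alpha>)"
  by (simp add: hyperexp_def)

lemma hyperexp_add: "hyperexp (n + m) = hyperexp n \<circ> hyperexp m"
  by (simp add: hyperexp_def funpow_add)

lemma one_le_omega_exp: "1 \<le> omega_exp \<alpha>"
  by transfer (auto simp: less_eq_cnf_def less_CZero_iff)

lemma one_add_hyperexp_one: "1 + hyperexp 1 \<alpha> = omega_exp \<alpha>"
  unfolding hyperexp_one by (simp add: add_left_diff one_le_omega_exp)

lemma hyperexp_pos: "0 < \<alpha> \<Longrightarrow> 0 < hyperexp n \<alpha>"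
proof (induction n)
  case (Suc n)
  have "0 < hyperexp 1 \<beta>" if "0 < \<beta>" for \<beta>
  proof (rule ccontr)
    assume "\<not> 0 < hyperexp 1 \<beta>"
    then have "hyperexp 1 \<beta> = 0" by (simp add: eps0_pos_iff)
    then have "omega_exp \<beta> = omega_exp 0"
      using one_add_hyperexp_one[of \<beta>] by (simp add: omega_exp_zero)
    then show False using omega_exp_strict_mono[OF that] by simp
  qed
  moreover have "hyperexp (Suc n) \<alpha> = hyperexp 1 (hyperexp n \<alpha>)"
    using hyperexp_add[of 1 n] by simp
  ultimately show ?case using Suc by simp
qed (simp add: hyperexp_zero)


section \<open>Formulas\<close>

datatype fm = Top | Conj fm fm | Mod nat eps0 fm

text \<open>
  \<open>dia n \<alpha> \<phi>\<close> is \<open>\<langle>n\<^sup>\<alpha>\<rangle>\<phi>\<close> under the convention that \<open>\<langle>n\<^sup>0\<rangle>\<phi>\<close> denotes \<open>\<phi>\<close>. The constructor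
  \<open>Mod\<close> is thus a proper modality only for positive exponents, and \<open>Mod n 0 \<phi>\<close> is not a
  formula of the language \<open>Fm\<close>.
\<close>

definition dia :: "nat \<Rightarrow> eps0 \<Rightarrow> fm \<Rightarrow> fm" where
  "dia n \<alpha> \<phi> = (if \<alpha> = 0 then \<phi> else Mod n \<alpha> \<phi>)"

inductive_set Fm :: "fm set" where
  Top: "Top \<in> Fm"
| Conj: "\<phi> \<in> Fm \<Longrightarrow> \<psi> \<in> Fm \<Longrightarrow> Conj \<phi> \<psi> \<in> Fm"
| dia: "\<phi> \<in> Fm \<Longrightarrow> dia n \<alpha> \<phi> \<in> Fm"

fun worm :: "(nat \<times> eps0) list \<Rightarrow> fm" where
  "worm [] = Top"
| "worm ((n, \<alpha>) # w) = Mod n \<alpha> (worm w)"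

inductive_set IncNF :: "fm set" where
  Top: "Top \<in> IncNF"
| single: "0 < \<alpha> \<Longrightarrow> Mod n \<alpha> Top \<in> IncNF"
| step: "Mod m \<beta> A \<in> IncNF \<Longrightarrow> n < m \<Longrightarrow> 0 < \<alpha> \<Longrightarrow> Mod n \<alpha> (Mod m \<beta> A) \<in> IncNF"

fun mon_conj :: "(nat \<times> eps0) list \<Rightarrow> fm" where
  "mon_conj [] = Top"
| "mon_conj [(n, \<alpha>)] = Mod n \<alpha> Top"
| "mon_conj ((n, \<alpha>) # p # ps) = Conj (Mod n \<alpha> Top) (mon_conj (p # ps))"

text \<open>
  Monomials are built with \<open>Mod\<close> and positive exponents, the monomial with exponent \<open>0\<close> being
  \<open>Top\<close> itself. Reading \<open>Top\<close> as a monomial \<open>\<langle>n\<^sub>0\<^sup>0\<rangle>\<top>\<close> in the last clause, or in the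
  Schmerl axioms below, would make \<open>\<langle>n\<^sup>\<alpha>\<rangle>\<top>\<close> derivably equivalent to \<open>\<top>\<close>.
\<close>

inductive_set MNF :: "fm set" where
  Top: "Top \<in> MNF"
| monomial: "0 < \<alpha> \<Longrightarrow> Mod n \<alpha> Top \<in> MNF"
| step: "mon_conj ((n\<^sub>0, \<alpha>\<^sub>0) # ps) \<in> MNF \<Longrightarrow> n < n\<^sub>0 \<Longrightarrow>
    \<alpha> = hyperexp (n\<^sub>0 - n) \<alpha>\<^sub>0 * (2 + \<beta>) \<Longrightarrow>
    mon_conj ((n, \<alpha>) # (n\<^sub>0, \<alpha>\<^sub>0) # ps) \<in> MNF"


section \<open>The calculus TSC\<close>

inductive TSC :: "fm \<Rightarrow> fm \<Rightarrow> bool" (infix \<open>\<turnstile>\<close> 50) where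
  refl: "\<phi> \<in> Fm \<Longrightarrow> \<phi> \<turnstile> \<phi>"
| top: "\<phi> \<in> Fm \<Longrightarrow> \<phi> \<turnstile> Top"
| conj1: "\<phi> \<in> Fm \<Longrightarrow> \<psi> \<in> Fm \<Longrightarrow> Conj \<phi> \<psi> \<turnstile> \<phi>"
| conj2: "\<phi> \<in> Fm \<Longrightarrow> \<psi> \<in> Fm \<Longrightarrow> Conj \<phi> \<psi> \<turnstile> \<psi>"
| mono: "\<phi> \<in> Fm \<Longrightarrow> \<beta> \<le> \<alpha> \<Longrightarrow> dia n \<alpha> \<phi> \<turnstile> dia n \<beta> \<phi>"
| coadd1: "\<phi> \<in> Fm \<Longrightarrow> dia n (\<alpha> + \<beta>) \<phi> \<turnstile> dia n \<beta> (dia n \<alpha> \<phi>)"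
| coadd2: "\<phi> \<in> Fm \<Longrightarrow> dia n \<beta> (dia n \<alpha> \<phi>) \<turnstile> dia n (\<alpha> + \<beta>) \<phi>"
| reduction: "\<phi> \<in> Fm \<Longrightarrow> dia (m + n) \<alpha> \<phi> \<turnstile> dia m (hyperexp n \<alpha>) \<phi>"
| schmerl1: "mon_conj ((n\<^sub>0, \<alpha>\<^sub>0) # ps) \<in> MNF \<Longrightarrow> n < n\<^sub>0 \<Longrightarrow>
    dia n \<alpha> (mon_conj ((n\<^sub>0, \<alpha>\<^sub>0) # ps)) \<turnstile>
    mon_conj ((n, hyperexp (n\<^sub>0 - n) \<alpha>\<^sub>0 * (1 + \<alpha>)) # (n\<^sub>0, \<alpha>\<^sub>0) # ps)"
| schmerl2: "mon_conj ((n\<^sub>0, \<alpha>\<^sub>0) # ps) \<in> MNF \<Longrightarrow> n < n\<^sub>0 \<Longrightarrow>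
    mon_conj ((n, hyperexp (n\<^sub>0 - n) \<alpha>\<^sub>0 * (1 + \<alpha>)) # (n\<^sub>0, \<alpha>\<^sub>0) # ps) \<turnstile>
    dia n \<alpha> (mon_conj ((n\<^sub>0, \<alpha>\<^sub>0) # ps))"
| conjI: "\<phi> \<turnstile> \<psi> \<Longrightarrow> \<phi> \<turnstile> \<chi> \<Longrightarrow> \<phi> \<turnstile> Conj \<psi> \<chi>"
| cut: "\<phi> \<turnstile> \<psi> \<Longrightarrow> \<psi> \<turnstile> \<chi> \<Longrightarrow> \<phi> \<turnstile> \<chi>"
| necessitation: "\<phi> \<turnstile> \<psi> \<Longrightarrow> dia n \<alpha> \<phi> \<turnstile> dia n \<alpha> \<psi>"
| distribution: "\<phi> \<turnstile> \<psi> \<Longrightarrow> m < n \<Longrightarrow>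
    Conj (dia n \<alpha> \<phi>) (dia m (\<beta> + 1) \<psi>) \<turnstile> dia n \<alpha> (Conj \<phi> (dia m (\<beta> + 1) \<psi>))"

definition TSC_equiv :: "fm \<Rightarrow> fm \<Rightarrow> bool" (infix \<open>\<equiv>\<^sub>T\<close> 50) where
  "\<phi> \<equiv>\<^sub>T \<psi> \<longleftrightarrow> \<phi> \<turnstile> \<psi> \<and> \<psi> \<turnstile> \<phi>"

lemma Mod_in_Fm: "\<phi> \<in> Fm \<Longrightarrow> 0 < \<alpha> \<Longrightarrow> Mod n \<alpha> \<phi> \<in> Fm"
  using Fm.dia[of \<phi> n \<alpha>] by (simp add: dia_def eps0_pos_iff)

lemma IncNF_subset_Fm: "A \<in> IncNF \<Longrightarrow> A \<in> Fm"
  by (induction rule: IncNF.induct) (auto intro: Mod_in_Fm Fm.Top)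

lemma mon_conj_in_Fm_iff: "mon_conj ps \<in> Fm \<longleftrightarrow> (\<forall>(n, \<alpha>) \<in> set ps. 0 < \<alpha>)"
proof (induction ps rule: mon_conj.induct)
  have Mod_iff: "Mod n \<alpha> Top \<in> Fm \<longleftrightarrow> 0 < \<alpha>" for n \<alpha>
  proof
    have "\<psi> \<in> Fm \<Longrightarrow> \<psi> = Mod n \<alpha> Top \<Longrightarrow> 0 < \<alpha>" for \<psi>
      by (induction rule: Fm.induct)
         (auto simp: dia_def eps0_pos_iff split: if_splits)
    then show "Mod n \<alpha> Top \<in> Fm \<Longrightarrow> 0 < \<alpha>" by blast
  qed (simp add: Mod_in_Fm Fm.Top)
  have Conj_iff: "Conj \<phi> \<chi> \<in> Fm \<longleftrightarrow> \<phi> \<in> Fm \<and> \<chi> \<in> Fm" for \<phi> \<chi>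
  proof
    have "\<psi> \<in> Fm \<Longrightarrow> \<psi> = Conj \<phi> \<chi> \<Longrightarrow> \<phi> \<in> Fm \<and> \<chi> \<in> Fm" for \<psi>
      by (induction rule: Fm.induct) (auto simp: dia_def split: if_splits)
    then show "Conj \<phi> \<chi> \<in> Fm \<Longrightarrow> \<phi> \<in> Fm \<and> \<chi> \<in> Fm" by blast
  qed (simp add: Fm.Conj)
  {
    case 1
    show ?case by (simp add: Fm.Top)
  next
    case (2 n \<alpha>)
    show ?case by (simp add: Mod_iff)
  next
    case (3 n \<alpha> p ps)
    then show ?case by (simp add: Mod_iff Conj_iff)
  }
qed

lemma mult_add_pos:
  assumes "0 < \<alpha>" "0 < \<beta>"
  shows "0 < hyperexp n \<alpha> * (\<beta> + \<gamma>)"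
proof -
  have "0 < \<beta> + \<gamma>" using assms(2) eps0_le_iff_add[of \<beta> "\<beta> + \<gamma>"] by auto
  then show ?thesis by (intro eps0_mult_pos hyperexp_pos assms)
qed

lemma eps0_zero_less_one: "(0 :: eps0) < 1"
  by transfer simp

lemma MNF_subset_Fm: "\<psi> \<in> MNF \<Longrightarrow> \<psi> \<in> Fm"
proof (induction rule: MNF.induct)
  case (step n\<^sub>0 \<alpha>\<^sub>0 ps n \<alpha> \<beta>)
  then have "0 < \<alpha>\<^sub>0" by (simp add: mon_conj_in_Fm_iff)
  then have "0 < \<alpha>"
    using mult_add_pos[OF _ eps0_zero_less_one, of \<alpha>\<^sub>0 "n\<^sub>0 - n" "1 + \<beta>"] step.hyps
    by (simp add: add.assoc[symmetric])
  then show ?case using step.IH by (simp add: mon_conj_in_Fm_iff del: mon_conj.simps)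
qed (auto intro: Mod_in_Fm Fm.Top)

lemma TSC_in_Fm: "\<phi> \<turnstile> \<psi> \<Longrightarrow> \<phi> \<in> Fm \<and> \<psi> \<in> Fm"
proof (induction rule: TSC.induct)
  case (schmerl1 n\<^sub>0 \<alpha>\<^sub>0 ps n \<alpha>)
  then have *: "mon_conj ((n\<^sub>0, \<alpha>\<^sub>0) # ps) \<in> Fm" using MNF_subset_Fm by blast
  then show ?case
    using mult_add_pos eps0_zero_less_one by (auto intro: Fm.dia simp: mon_conj_in_Fm_iff simp del: mon_conj.simps)
next
  case (schmerl2 n\<^sub>0 \<alpha>\<^sub>0 ps n \<alpha>)
  then have *: "mon_conj ((n\<^sub>0, \<alpha>\<^sub>0) # ps) \<in> Fm" using MNF_subset_Fm by blast
  then show ?case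
    using mult_add_pos eps0_zero_less_one by (auto intro: Fm.dia simp: mon_conj_in_Fm_iff simp del: mon_conj.simps)
qed (auto intro: Fm.intros)

end

theory Submission
  imports Defs
begin

text \<open>
  Induction on the length of the worm, from the innermost modality outwards: one Schmerl axiom
  moves each further modality into the conjunction. The result is in MNF because its exponent
  \<open>\<beta> > 0\<close> can be written \<open>1 + \<beta>'\<close>, so that \<open>1 + \<beta> = 2 + \<beta>'\<close>.
\<close>

text \<open>Links the factor \<open>1 + \<beta>\<close> of the Schmerl axioms to the factor
  \<open>2 + \<beta>'\<close> required by \<open>MNF\<close>. A positive \<beta> starts with 1, and
  associativity merges the two leading ones; no commutativity is involved.\<close>

lemma one_add_pos_eq_two_add:
  fixes \<beta> :: eps0
  assumes "0 < \<beta>"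
  obtains \<beta>' where "1 + \<beta> = 2 + \<beta>'"
proof -
  have "1 \<le> \<beta>"
    using assms eps0_less_add_one_iff[of \<beta> 0] by (simp add: not_less[symmetric])
  then obtain \<beta>' where "\<beta> = 1 + \<beta>'"
    using eps0_le_iff_add by blast
  then have "1 + \<beta> = 2 + \<beta>'"
    by (simp add: add.assoc[symmetric] one_add_one)
  then show thesis by (rule that)
qed

text \<open>\<open>upt_Suc\<close> splits a range at its end, whereas \<open>worm\<close> and
  \<open>mon_conj\<close> recurse at the head.\<close>

lemma map_upt_Suc_shift: "map f [0..<Suc k] = f 0 # map (\<lambda>i. f (Suc i)) [0..<k]"
  by (simp add: upt_conv_Cons map_Suc_upt[symmetric] del: upt_Suc)

lemma TSC_equiv_refl: "\<phi> \<in> Fm \<Longrightarrow> \<phi> \<equiv>\<^sub>T \<phi>"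
  by (simp add: TSC_equiv_def TSC.refl)

lemma TSC_equiv_trans: "\<phi> \<equiv>\<^sub>T \<psi> \<Longrightarrow> \<psi> \<equiv>\<^sub>T \<chi> \<Longrightarrow> \<phi> \<equiv>\<^sub>T \<chi>"
  unfolding TSC_equiv_def by (blast intro: TSC.cut)

lemma TSC_equiv_dia: "\<phi> \<equiv>\<^sub>T \<psi> \<Longrightarrow> dia n \<alpha> \<phi> \<equiv>\<^sub>T dia n \<alpha> \<psi>"
  unfolding TSC_equiv_def by (blast intro: TSC.necessitation)

lemma TSC_equiv_schmerl:
  "mon_conj ((n\<^sub>0, \<alpha>\<^sub>0) # ps) \<in> MNF \<Longrightarrow> n < n\<^sub>0 \<Longrightarrow>
    dia n \<alpha> (mon_conj ((n\<^sub>0, \<alpha>\<^sub>0) # ps)) \<equiv>\<^sub>T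
    mon_conj ((n, hyperexp (n\<^sub>0 - n) \<alpha>\<^sub>0 * (1 + \<alpha>)) # (n\<^sub>0, \<alpha>\<^sub>0) # ps)"
  unfolding TSC_equiv_def by (blast intro: TSC.schmerl1 TSC.schmerl2)

theorem theorem5p2:
  fixes k :: nat and n :: "nat \<Rightarrow> nat" and \<beta> :: "nat \<Rightarrow> eps0" and A :: fm
  assumes "A = worm (map (\<lambda>i. (n i, \<beta> i)) [0..<Suc k])"
    and "A \<in> IncNF"
  shows "\<exists>\<psi> \<in> MNF. A \<equiv>\<^sub>T \<psi> \<and>
    (\<exists>\<alpha> :: nat \<Rightarrow> eps0.
       \<psi> = mon_conj (map (\<lambda>i. (n i, \<alpha> i)) [0..<Suc k]) \<and>
       \<alpha> k = \<beta> k \<and>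
       (\<forall>i<k. \<alpha> i = hyperexp (n (Suc i) - n i) (\<alpha> (Suc i)) * (1 + \<beta> i)))"
  using assms
proof (induction k arbitrary: n \<beta> A)
  case 0
  \<comment> \<open>A single modality is already a monomial, so \<open>A\<close> itself serves as
    \<psi> and \<beta> as \<alpha>.\<close>
  then have A: "A = Mod (n 0) (\<beta> 0) Top" by simp
  then have "0 < \<beta> 0" using 0(2) by (auto elim: IncNF.cases)
  then have "A \<in> MNF" using A by (simp add: MNF.monomial)
  moreover have "A \<equiv>\<^sub>T A" using 0(2) by (simp add: TSC_equiv_refl IncNF_subset_Fm)
  ultimately show ?case
    using A by (intro bexI[of _ A]) auto
next
  case (Suc k)
  \<comment> \<open>The worm without its outermost modality; the induction hypothesis applies to it
    with the indices of \<open>n\<close> and \<beta> shifted by one.\<close>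
  define B where "B = worm (map (\<lambda>i. (n (Suc i), \<beta> (Suc i))) [0..<Suc k])"
  have A: "A = Mod (n 0) (\<beta> 0) B"
    unfolding B_def Suc.prems(1) by (subst map_upt_Suc_shift) simp
  \<comment> \<open>Since \<open>B\<close> is not \<open>Top\<close>, inversion of
    \<open>IncNF\<close> leaves only the clause that gives \<open>n 0 < n 1\<close>.\<close>
  obtain C where C: "B = Mod (n 1) (\<beta> 1) C"
    unfolding B_def map_upt_Suc_shift by simp
  have B: "B \<in> IncNF" and lt: "n 0 < n 1" and pos: "0 < \<beta> 0"
    using Suc.prems(2) unfolding A C by (auto elim: IncNF.cases)
  obtain \<alpha> where
      MNF: "mon_conj (map (\<lambda>i. (n (Suc i), \<alpha> i)) [0..<Suc k]) \<in> MNF" and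
      eqv: "B \<equiv>\<^sub>T mon_conj (map (\<lambda>i. (n (Suc i), \<alpha> i)) [0..<Suc k])" and
      last: "\<alpha> k = \<beta> (Suc k)" and
      rec: "\<forall>i<k. \<alpha> i = hyperexp (n (Suc (Suc i)) - n (Suc i)) (\<alpha> (Suc i)) * (1 + \<beta> (Suc i))"
    using Suc.IH[OF B_def B] by blast
  obtain ps where l: "map (\<lambda>i. (n (Suc i), \<alpha> i)) [0..<Suc k] = (n 1, \<alpha> 0) # ps"
    unfolding map_upt_Suc_shift by simp
  \<comment> \<open>The exponent that the Schmerl axiom creates at base \<open>n 0\<close>; here
    \<open>\<alpha> 0\<close> belongs to base \<open>n 1\<close>, because \<alpha> is still shifted.
    Prepending \<gamma> as \<open>\<alpha>' 0\<close> undoes the shift.\<close>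
  define \<gamma> where "\<gamma> = hyperexp (n 1 - n 0) (\<alpha> 0) * (1 + \<beta> 0)"
  define \<alpha>' where "\<alpha>' = case_nat \<gamma> \<alpha>"
  have l': "map (\<lambda>i. (n i, \<alpha>' i)) [0..<Suc (Suc k)] = (n 0, \<gamma>) # (n 1, \<alpha> 0) # ps"
    by (subst map_upt_Suc_shift) (simp add: \<alpha>'_def l del: upt_Suc)
  obtain \<beta>' where "1 + \<beta> 0 = 2 + \<beta>'"
    using one_add_pos_eq_two_add[OF pos] .
  then have "mon_conj ((n 0, \<gamma>) # (n 1, \<alpha> 0) # ps) \<in> MNF"
    using MNF lt unfolding l \<gamma>_def by (auto intro!: MNF.step simp del: mon_conj.simps)
  moreover have "A \<equiv>\<^sub>T mon_conj ((n 0, \<gamma>) # (n 1, \<alpha> 0) # ps)"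
  proof -
    \<comment> \<open>Rewrite \<open>B\<close> under the modality by necessitation, then absorb the
      modality by the Schmerl axiom.\<close>
    have "A = dia (n 0) (\<beta> 0) B" using pos by (simp add: A dia_def)
    then show ?thesis
      using TSC_equiv_trans[OF TSC_equiv_dia[OF eqv[unfolded l]]
          TSC_equiv_schmerl[OF MNF[unfolded l] lt]]
      by (simp only: \<gamma>_def)
  qed
  moreover have "\<alpha>' (Suc k) = \<beta> (Suc k)"
    by (simp add: \<alpha>'_def last)
  moreover have "\<forall>i<Suc k. \<alpha>' i = hyperexp (n (Suc i) - n i) (\<alpha>' (Suc i)) * (1 + \<beta> i)"
    \<comment> \<open>Index 0 is the choice of \<gamma>; a successor index is \<open>rec\<close>
      shifted.\<close>
    using rec by (auto simp: \<alpha>'_def \<gamma>_def less_Suc_eq_0_disj)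
  ultimately show ?case unfolding l'[symmetric] by blast
qed

end
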